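(* Let $0<\alpha\le 1$ and let $\{\mathcal{N}^{\alpha}_{c}(t)\}_{t\ge 0}$ be the convoluted fractional Poisson process with intensity parameters $\{\lambda_j\}_{j\in\mathbb{Z}}$ (so $\lambda_{-1}=0$). Then for every $w\ge 0$ and $t\ge 0$ the moment generating function $m^{\alpha}_{c}(w,t)=\mathbb{E}\big(e^{-w\mathcal{N}^{\alpha}_{c}(t)}\big)$ is given by $$m^{\alpha}_{c}(w,t)=E_{\alpha,1}\left(t^{\alpha}\sum_{j=0}^{\infty}(\lambda_{j-1}-\lambda_{j})e^{-wj}\right).$$
   Context: $\mathbb{N}_0$ denotes the non-negative integers. Mittag-Leffler function: $E_{\alpha,1}(x)=\sum_{k=0}^\infty \frac{x^k}{\Gamma(k\alpha+1)}$. Intensity parameters: $\{\lambda_j\}_{j\in\mathbb{Z}}$ are real numbers with $\lambda_j=0$ for $j<0$, $\lambda_0>0$, $\lambda_j\ge 0$ for $j>0$, non-increasing for $j\ge 0$, and $\lim_{j\to\infty}\lambda_{j+1}/\lambda_j<1$ (this limit condition is regarded as satisfied if $\lambda_j=0$ for all large $j$). Fractional derivative (Dzhrbashyan–Caputo): $\partial_t^{\alpha}f(t)=\frac{1}{\Gamma(1-\alpha)}\int_0^t (t-s)^{-\alpha}f'(s)\,\mathrm{d}s$ for $0<\alpha<1$, and $\partial_t^{1}f(t)=f'(t)$. Convoluted fractional Poisson process (CFPP): an $\mathbb{N}_0$-valued stochastic process $\{\mathcal{N}^{\alpha}_{c}(t)\}_{t\ge0}$ whose state probabilities $p^{\alpha}_{c}(n,t)=\Pr\{\mathcal{N}^{\alpha}_{c}(t)=n\}$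 satisfy, for all $n\ge 0$, $$\partial_t^{\alpha}p^{\alpha}_{c}(n,t)=-\lambda_n * p^{\alpha}_{c}(n,t)+\lambda_{n-1}*p^{\alpha}_{c}(n-1,t),$$ where $\lambda_n*p^{\alpha}_{c}(n,t)=\sum_{j=-\infty}^{\infty}\lambda_j p^{\alpha}_{c}(n-j,t)$ is the discrete convolution in the space variable, with $p^{\alpha}_{c}(0,0)=1$, $p^{\alpha}_{c}(n,0)=0$ for $n\ge 1$, and $p^{\alpha}_{c}(-n,t)=0$ for $n\ge 1$, $t\ge 0$. Equivalently, $\partial_t^{\alpha}p^{\alpha}_{c}(n,t)=-\lambda_0 p^{\alpha}_{c}(n,t)+\sum_{j=1}^{n}(\lambda_{j-1}-\lambda_j)p^{\alpha}_{c}(n-j,t)$. *)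

theory Defs
  imports "HOL-Probability.Probability"
begin

definition mittag_leffler :: "real \<Rightarrow> real \<Rightarrow> real \<Rightarrow> real" where
  "mittag_leffler \<alpha> \<beta> x = (\<Sum>k. x ^ k / Gamma (real k * \<alpha> + \<beta>))"

text \<open>The second disjunct of the last conjunct makes explicit the convention that the ratio
  condition counts as satisfied for sequences that vanish eventually.\<close>

definition intensity_parameters :: "(int \<Rightarrow> real) \<Rightarrow> bool" where
  "intensity_parameters lam \<longleftrightarrow>
     (\<forall>j<0. lam j = 0) \<and> lam 0 > 0 \<and> (\<forall>j>0. lam j \<ge> 0) \<and>
     (\<forall>i j. 0 \<le> i \<longrightarrow> i \<le> j \<longrightarrow> lam j \<le> lam i) \<and>
     ((\<exists>L<1. ((\<lambda>j. lam (j + 1) / lam j) \<longlongrightarrow> L) at_top) \<or>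
      (\<forall>\<^sub>F j in at_top. lam j = 0))"

text \<open>The Dzhrbashyan-Caputo derivative of order \<open>0 < \<alpha> \<le> 1\<close> at \<open>t > 0\<close>. The predicate
  \<open>caputo_differentiable\<close> says that the expression defining \<open>caputo_deriv\<close> is meaningful:
  the ordinary derivative occurring in it exists and, for \<open>\<alpha> < 1\<close>, the weakly singular
  integral converges.\<close>

definition caputo_deriv :: "real \<Rightarrow> (real \<Rightarrow> real) \<Rightarrow> real \<Rightarrow> real" where
  "caputo_deriv \<alpha> f t =
     (if \<alpha> = 1 then deriv f t
      else 1 / Gamma (1 - \<alpha>) * (LBINT s:{0<..<t}. (t - s) powr (- \<alpha>) * deriv f s))"

definition caputo_differentiable :: "real \<Rightarrow> (real \<Rightarrow> real) \<Rightarrow> real \<Rightarrow> bool" where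
  "caputo_differentiable \<alpha> f t \<longleftrightarrow>
     (if \<alpha> = 1 then f differentiable at t
      else (\<forall>s\<in>{0<..<t}. f differentiable at s) \<and>
           set_integrable lborel {0<..<t} (\<lambda>s. (t - s) powr (- \<alpha>) * deriv f s))"

definition discrete_convolution :: "(int \<Rightarrow> real) \<Rightarrow> (int \<Rightarrow> real) \<Rightarrow> int \<Rightarrow> real" where
  "discrete_convolution a b n = (\<Sum>\<^sub>\<infinity>j. a j * b (n - j))"

text \<open>State probabilities are indexed by \<^typ>\<open>int\<close>; those of negative states vanish because
  the process takes values in \<^typ>\<open>nat\<close>.\<close>

definition state_prob :: "'w measure \<Rightarrow> (real \<Rightarrow> 'w \<Rightarrow> nat) \<Rightarrow> int \<Rightarrow> real \<Rightarrow> real" where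
  "state_prob M N n t = measure M {\<omega> \<in> space M. int (N t \<omega>) = n}"

text \<open>The equation is imposed for \<open>t > 0\<close>: at \<open>t = 0\<close> the integral in the Caputo derivative is
  empty, while the right-hand side for \<open>n = 0\<close> is \<open>- lam 0 \<noteq> 0\<close>. Continuity on \<open>[0, \<infinity>)\<close> is what
  ties the initial values to the solution for positive times; together with the convergence of
  the integral it makes the state probabilities locally absolutely continuous on \<open>[0, \<infinity>)\<close>,
  the usual domain of the Caputo derivative. The values \<open>N t\<close> for \<open>t < 0\<close> play no role.\<close>

locale convoluted_fractional_poisson_process = prob_space M
  for M :: "'w measure" and N :: "real \<Rightarrow> 'w \<Rightarrow> nat"
    and \<alpha> :: real and lam :: "int \<Rightarrow> real" +
  assumes random_variable_N:
      "\<And>t. t \<ge> 0 \<Longrightarrow> N t \<in> measurable M (count_space UNIV)"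
    and continuous_state_prob:
      "\<And>n. n \<ge> 0 \<Longrightarrow> continuous_on {0..} (state_prob M N n)"
    and caputo_differentiable_state_prob:
      "\<And>n t. n \<ge> 0 \<Longrightarrow> t > 0 \<Longrightarrow> caputo_differentiable \<alpha> (state_prob M N n) t"
    and state_equation:
      "\<And>n t. n \<ge> 0 \<Longrightarrow> t > 0 \<Longrightarrow>
         caputo_deriv \<alpha> (state_prob M N n) t =
           - discrete_convolution lam (\<lambda>k. state_prob M N k t) n
           + discrete_convolution lam (\<lambda>k. state_prob M N k t) (n - 1)"
    and initial_zero: "state_prob M N 0 0 = 1"
    and initial_pos: "\<And>n. n \<ge> 1 \<Longrightarrow> state_prob M N n 0 = 0"

end

theory Submission
  imports Defs
begin

text \<open>Integrating the state equations with the Riemann-Liouville operator \<open>I\<^sup>\<alpha>\<close> gives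
  \<open>p\<^sub>n = p\<^sub>n(0) + I\<^sup>\<alpha> (\<Sum>\<^sub>i c\<^sub>i p\<^sub>n\<^sub>-\<^sub>i)\<close> with \<open>c\<^sub>i = \<lambda>\<^sub>i\<^sub>-\<^sub>1 - \<lambda>\<^sub>i\<close>. Summing against \<open>x\<^sup>n\<close>, where \<open>x = e\<^sup>-\<^sup>w\<close>,
  turns the convolution into a product, so \<open>F = \<Sum> x\<^sup>n p\<^sub>n\<close> satisfies the scalar equation
  \<open>F = 1 + C I\<^sup>\<alpha> F\<close> with \<open>C = \<Sum> c\<^sub>n x\<^sup>n\<close>. Since \<open>F\<close> is bounded, iterating this equation produces the
  Mittag-Leffler series with a remainder that tends to zero.\<close>

subsection \<open>Riemann-Liouville integrals\<close>

lemma has_bochner_integral_Beta: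
  fixes a b :: real
  assumes "a > 0" "b > 0"
  shows "has_bochner_integral lborel
    (\<lambda>x. indicator {0<..<1} x * (x powr (a - 1) * (1 - x) powr (b - 1))) (Beta a b)"
proof -
  have int: "set_integrable lborel {0<..<1} (\<lambda>x. x powr (a - 1) * (1 - x) powr (b - 1))"
    by (rule set_integrable_subset[OF integrable_Beta[OF assms]]) auto
  have "(LINT x:{0<..<1}|lborel. x powr (a - 1) * (1 - x) powr (b - 1)) = Beta a b"
    using has_integral_Beta_real[OF assms]
    by (simp add: set_borel_integral_eq_integral(2)[OF int] has_integral_Icc_iff_Ioo integral_unique)
  with int show ?thesis
    by (simp add: has_bochner_integral_iff set_integrable_def set_lebesgue_integral_def)
qed

text \<open>Substitute \<open>x = (s - u) / d\<close> with \<open>d = t - u\<close>: the two factors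
  contribute \<open>d powr (a + b - 2)\<close> and the Jacobian one more power of d. The factor
  \<open>(t - s)\<close> becomes \<open>1 - x\<close>, so the integral first appears as
  \<open>Beta b a\<close>.\<close>

lemma has_bochner_integral_Beta_Ioo:
  fixes a b u t :: real
  assumes "a > 0" "b > 0" "u < t"
  shows "has_bochner_integral lborel
    (\<lambda>s. indicator {u<..<t} s * ((t - s) powr (a - 1) * (s - u) powr (b - 1)))
    ((t - u) powr (a + b - 1) * Beta a b)"
proof -
  define d where "d = t - u"
  have d: "d > 0" using assms by (simp add: d_def)
  have "has_bochner_integral lborel
    (\<lambda>x. indicator {0<..<1} (- u / d + 1 / d * x) *
      ((- u / d + 1 / d * x) powr (b - 1) * (1 - (- u / d + 1 / d * x)) powr (a - 1)))
    (Beta b a /\<^sub>R \<bar>1 / d\<bar>)"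
    using lborel_has_bochner_integral_real_affine_iff[THEN iffD1,
        OF _ has_bochner_integral_Beta[OF assms(2,1)], of "1 / d" "- u / d"] d by simp
  then have "has_bochner_integral lborel
    (\<lambda>x. d powr (a + b - 2) * (indicator {0<..<1} (- u / d + 1 / d * x) *
      ((- u / d + 1 / d * x) powr (b - 1) * (1 - (- u / d + 1 / d * x)) powr (a - 1))))
    (d powr (a + b - 2) * (Beta b a /\<^sub>R \<bar>1 / d\<bar>))"
    by (rule has_bochner_integral_mult_right)
  moreover have "d powr (a + b - 2) * (indicator {0<..<1} (- u / d + 1 / d * s) *
      ((- u / d + 1 / d * s) powr (b - 1) * (1 - (- u / d + 1 / d * s)) powr (a - 1))) =
      indicator {u<..<t} s * ((t - s) powr (a - 1) * (s - u) powr (b - 1))" for s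
  proof -
    have eq: "- u / d + 1 / d * s = (s - u) / d" "1 - (s - u) / d = (t - s) / d"
      using d by (simp_all add: divide_simps) (simp add: d_def)
    have ind: "indicator {0<..<1} ((s - u) / d) = (indicator {u<..<t} s :: real)"
      using d by (auto simp: indicator_def field_simps d_def)
    show ?thesis
    proof (cases "s \<in> {u<..<t}")
      case True
      have "d powr (a + b - 2) = d powr (a - 1) * d powr (b - 1)"
        by (simp add: powr_add [symmetric])
      then show ?thesis
        unfolding eq(1) ind eq(2) using True d by (simp add: powr_divide)
    next
      case False
      then show ?thesis
        unfolding eq(1) ind by simp
    qed
  qed
  moreover have "d powr (a + b - 2) * (Beta b a /\<^sub>R \<bar>1 / d\<bar>) = d powr (a + b - 1) * Beta a b"
    using d powr_add[of d "a + b - 2" 1] by (simp add: Beta_commute)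
  ultimately show ?thesis
    by (simp add: d_def)
qed

section \<open>The fractional integral of order \<alpha>: powers, integrability and bounds\<close>

definition riemann_liouville :: "real \<Rightarrow> (real \<Rightarrow> real) \<Rightarrow> real \<Rightarrow> real" where
  "riemann_liouville \<alpha> f t = 1 / Gamma \<alpha> * (LBINT s:{0<..<t}. (t - s) powr (\<alpha> - 1) * f s)"

lemma riemann_liouville_cong:
  "(\<And>s. 0 < s \<Longrightarrow> s < t \<Longrightarrow> f s = g s) \<Longrightarrow> riemann_liouville \<alpha> f t = riemann_liouville \<alpha> g t"
  unfolding riemann_liouville_def by (auto intro!: set_lebesgue_integral_cong)

lemma riemann_liouville_integrable_powr:
  assumes "\<alpha> > 0" "b > -1"
  shows "set_integrable lborel {0<..<t::real} (\<lambda>s. (t - s) powr (\<alpha> - 1) * s powr b)"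
proof (cases "t > 0")
  case True
  then show ?thesis
    using has_bochner_integral_Beta_Ioo[of \<alpha> "b + 1" 0 t] assms
    by (simp add: set_integrable_def has_bochner_integral_iff)
qed (simp add: set_integrable_def)

text \<open>The integral is \<open>Beta \<alpha> (b + 1)\<close> times a power of t, and the
  prefactor \<open>1 / Gamma \<alpha>\<close> cancels one Gamma value of the Beta function.\<close>

lemma riemann_liouville_powr:
  assumes "\<alpha> > 0" "b > -1" "t > 0"
  shows "riemann_liouville \<alpha> (\<lambda>s. s powr b) t = Gamma (b + 1) / Gamma (\<alpha> + b + 1) * t powr (\<alpha> + b)"
proof -
  have "Gamma \<alpha> \<noteq> 0" using Gamma_real_pos[OF assms(1)] by linarith
  then show ?thesis
    using has_bochner_integral_Beta_Ioo[of \<alpha> "b + 1" 0 t] assms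
    by (simp add: set_lebesgue_integral_def has_bochner_integral_iff riemann_liouville_def Beta_def
         add.assoc)
qed

lemma riemann_liouville_integrable_bounded:
  fixes f :: "real \<Rightarrow> real"
  assumes "\<alpha> > 0" and meas: "set_borel_measurable borel {0<..<t} f"
    and bound: "\<And>s. 0 < s \<Longrightarrow> s < t \<Longrightarrow> \<bar>f s\<bar> \<le> B"
  shows "set_integrable lborel {0<..<t} (\<lambda>s. (t - s) powr (\<alpha> - 1) * f s)"
proof -
  have [measurable]: "(\<lambda>s. indicator {0<..<t} s * f s) \<in> borel_measurable borel"
    using meas by (simp add: set_borel_measurable_def)
  \<comment> \<open>The factor \<open>s powr 0\<close>, which is 1 on the interval, gives the
    majorant the shape of \<open>riemann_liouville_integrable_powr\<close> with b = 0.\<close>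
  have "set_integrable lborel {0<..<t} (\<lambda>s. B * ((t - s) powr (\<alpha> - 1) * s powr 0))"
    using riemann_liouville_integrable_powr[OF assms(1), of 0 t] by simp
  then show ?thesis
    unfolding set_integrable_def
  proof (rule Bochner_Integration.integrable_bound)
    have "(\<lambda>s. (t - s) powr (\<alpha> - 1) * (indicator {0<..<t} s * f s)) \<in> borel_measurable lborel"
      by measurable
    then show "(\<lambda>s. indicator {0<..<t} s *\<^sub>R ((t - s) powr (\<alpha> - 1) * f s)) \<in> borel_measurable lborel"
      by (simp add: mult.left_commute)
    show "AE s in lborel. norm (indicator {0<..<t} s *\<^sub>R ((t - s) powr (\<alpha> - 1) * f s))
        \<le> norm (indicator {0<..<t} s *\<^sub>R (B * ((t - s) powr (\<alpha> - 1) * s powr 0)))"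
    proof (rule AE_I2)
      fix s
      show "norm (indicator {0<..<t} s *\<^sub>R ((t - s) powr (\<alpha> - 1) * f s))
        \<le> norm (indicator {0<..<t} s *\<^sub>R (B * ((t - s) powr (\<alpha> - 1) * s powr 0)))"
      proof (cases "s \<in> {0<..<t}")
        case True
        then have "\<bar>f s\<bar> \<le> \<bar>B\<bar>" using bound[of s] by auto
        then show ?thesis using True
          by (auto simp: abs_mult mult.commute[of "\<bar>B\<bar>"] intro!: mult_left_mono)
      qed auto
    qed
  qed
qed

lemma abs_riemann_liouville_le:
  assumes "\<alpha> > 0" "b \<ge> 0" "t > 0"
    and bound: "\<And>s. 0 < s \<Longrightarrow> s < t \<Longrightarrow> \<bar>f s\<bar> \<le> B * s powr b"
  shows "\<bar>riemann_liouville \<alpha> f t\<bar> \<le> B * (Gamma (b + 1) / Gamma (\<alpha> + b + 1) * t powr (\<alpha> + b))"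
proof -
  have G: "Gamma \<alpha> > 0" using assms by simp
  have "set_integrable lborel {0<..<t} (\<lambda>s. B * ((t - s) powr (\<alpha> - 1) * s powr b))"
    using riemann_liouville_integrable_powr[of \<alpha> b t] assms by simp
  then have "norm (LBINT s:{0<..<t}. (t - s) powr (\<alpha> - 1) * f s)
      \<le> (LBINT s:{0<..<t}. B * ((t - s) powr (\<alpha> - 1) * s powr b))"
    unfolding set_lebesgue_integral_def set_integrable_def
  \<comment> \<open>\<open>integral_mono'\<close> asks for integrability of the majorant only, so it
    also covers the case where the left integral has the default value 0.\<close>
  proof (intro order.trans[OF integral_norm_bound integral_mono'])
    fix s
    have "0 \<le> B * s powr b" if "s \<in> {0<..<t}"
      using bound[of s] that by (intro order.trans[OF abs_ge_zero]) auto
    then show "0 \<le> indicator {0<..<t} s *\<^sub>R (B * ((t - s) powr (\<alpha> - 1) * s powr b))"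
      by (auto simp: indicator_def mult.left_commute[of B])
    show "norm (indicator {0<..<t} s *\<^sub>R ((t - s) powr (\<alpha> - 1) * f s))
        \<le> indicator {0<..<t} s *\<^sub>R (B * ((t - s) powr (\<alpha> - 1) * s powr b))"
      using bound[of s]
      by (auto simp: indicator_def abs_mult mult.left_commute[of B] intro!: mult_left_mono)
  qed
  also have "\<dots> = B * (Gamma \<alpha> * riemann_liouville \<alpha> (\<lambda>s. s powr b) t)"
    using G by (simp add: riemann_liouville_def)
  finally have "\<bar>LBINT s:{0<..<t}. (t - s) powr (\<alpha> - 1) * f s\<bar> / Gamma \<alpha>
      \<le> B * (Gamma \<alpha> * riemann_liouville \<alpha> (\<lambda>s. s powr b) t) / Gamma \<alpha>"
    using G by (intro divide_right_mono) auto
  also have "\<dots> = B * riemann_liouville \<alpha> (\<lambda>s. s powr b) t"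
    using G by simp
  also have "riemann_liouville \<alpha> (\<lambda>s. s powr b) t
      = Gamma (b + 1) / Gamma (\<alpha> + b + 1) * t powr (\<alpha> + b)"
    using assms by (intro riemann_liouville_powr) auto
  finally show ?thesis
    using G by (simp add: riemann_liouville_def abs_mult)
qed

lemma riemann_liouville_diff:
  assumes "set_integrable lborel {0<..<t} (\<lambda>s. (t - s) powr (\<alpha> - 1) * f s)"
    and "set_integrable lborel {0<..<t} (\<lambda>s. (t - s) powr (\<alpha> - 1) * g s)"
  shows "riemann_liouville \<alpha> (\<lambda>s. f s - g s) t = riemann_liouville \<alpha> f t - riemann_liouville \<alpha> g t"
  using set_integral_diff(2)[OF assms] by (simp add: riemann_liouville_def right_diff_distrib diff_divide_distrib)

subsection \<open>Linear Volterra equations and the Mittag-Leffler series\<close>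

text \<open>Restrict the Gamma integral to \<open>{A..}\<close>, where \<open>t powr y\<close> is at
  least \<open>A powr y\<close>. Since A is free, Gamma outgrows every exponential.\<close>

lemma Gamma_plus1_ge:
  fixes y A :: real
  assumes "y \<ge> 0" "A > 0"
  shows "A powr y * exp (- A) \<le> Gamma (y + 1)"
proof -
  have G: "((\<lambda>t. t powr y / exp t) has_integral Gamma (y + 1)) {0..}"
    using Gamma_integral_real[of "y + 1"] assms by simp
  have E: "((\<lambda>t. A powr y * exp (- t)) has_integral A powr y * exp (- A)) {A..}"
    using has_integral_mult_right[OF has_integral_exp_minus_to_infinity[of 1 A]] by simp
  have "((\<lambda>t. if t \<in> {A..} then A powr y * exp (- t) else 0) has_integral A powr y * exp (- A)) {0..}"
    using E assms by (subst has_integral_restrict) auto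
  then show ?thesis
    by (rule has_integral_le[OF _ G])
      (use assms in \<open>auto simp: exp_minus field_simps intro!: powr_mono2\<close>)
qed

lemma power_over_Gamma_tendsto_0:
  fixes \<alpha> x :: real
  assumes "\<alpha> > 0" "x \<ge> 0"
  shows "(\<lambda>k. x ^ k / Gamma (real k * \<alpha> + 1)) \<longlonglongrightarrow> 0"
proof -
  \<comment> \<open>This A turns the lower bound for Gamma into a multiple of
    \<open>(2 * x + 1) ^ k\<close>; the quotient \<open>x / (2 * x + 1)\<close> is below 1, also for
    x = 0.\<close>
  define A where "A = (2 * x + 1) powr (1 / \<alpha>)"
  have A: "A > 0" "A powr \<alpha> = 2 * x + 1"
    using assms by (auto simp: A_def powr_powr)
  have "(\<lambda>k. exp A * (x / (2 * x + 1)) ^ k) \<longlonglongrightarrow> exp A * 0"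
    using assms by (intro tendsto_mult tendsto_const LIMSEQ_power_zero) auto
  then have lim: "(\<lambda>k. exp A * (x / (2 * x + 1)) ^ k) \<longlonglongrightarrow> 0" by simp
  show ?thesis
  proof (rule tendsto_sandwich[OF _ _ tendsto_const lim])
    show "\<forall>\<^sub>F k in sequentially. 0 \<le> x ^ k / Gamma (real k * \<alpha> + 1)"
      using assms by (intro always_eventually allI divide_nonneg_nonneg Gamma_real_nonneg)
        (auto intro: add_nonneg_pos)
    show "\<forall>\<^sub>F k in sequentially. x ^ k / Gamma (real k * \<alpha> + 1) \<le> exp A * (x / (2 * x + 1)) ^ k"
    proof (intro always_eventually allI)
      fix k
      have "A powr (real k * \<alpha>) = (2 * x + 1) ^ k"
        using A assms by (simp add: mult.commute[of "real k"] powr_powr[symmetric] powr_realpow)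
      then have "(2 * x + 1) ^ k * exp (- A) \<le> Gamma (real k * \<alpha> + 1)"
        using Gamma_plus1_ge[of "real k * \<alpha>" A] A assms by simp
      then have "x ^ k / Gamma (real k * \<alpha> + 1) \<le> x ^ k / ((2 * x + 1) ^ k * exp (- A))"
        using assms by (intro divide_left_mono mult_pos_pos Gamma_real_pos zero_less_power exp_gt_zero)
          (auto intro: add_nonneg_pos)
      then show "x ^ k / Gamma (real k * \<alpha> + 1) \<le> exp A * (x / (2 * x + 1)) ^ k"
        by (simp add: exp_minus power_divide field_simps)
    qed
  qed
qed

text \<open>Iterating the equation \<open>K\<close> times leaves the remainder \<open>C\<^sup>K I\<^sup>\<alpha>\<^sup>K f\<close>, which is at most
  \<open>B \<bar>C\<bar>\<^sup>K t\<^sup>\<alpha>\<^sup>K / \<Gamma>(\<alpha>K + 1)\<close>.\<close>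

lemma riemann_liouville_volterra_sums:
  fixes f :: "real \<Rightarrow> real"
  assumes "\<alpha> > 0" "t > 0"
    and meas: "\<And>t. set_borel_measurable borel {0<..<t} f"
    and bound: "\<And>s. s > 0 \<Longrightarrow> \<bar>f s\<bar> \<le> B"
    and eq: "\<And>s. s > 0 \<Longrightarrow> f s = 1 + C * riemann_liouville \<alpha> f s"
  shows "(\<lambda>k. (C * t powr \<alpha>) ^ k / Gamma (real k * \<alpha> + 1)) sums f t"
proof -
  \<comment> \<open>\<open>T k\<close> is the k-th term of the series as a function of time, written
    with \<open>powr\<close> so that \<open>riemann_liouville_powr\<close> applies;
    \<open>R K\<close> is the remainder after K terms.\<close>
  define T where "T k s = C ^ k / Gamma (real k * \<alpha> + 1) * s powr (real k * \<alpha>)" for k s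
  define R where "R K s = f s - (\<Sum>k<K. T k s)" for K s
  have R_Suc: "R (Suc K) = (\<lambda>s. R K s - T K s)" for K
    by (auto simp: R_def)
  have Gpos: "Gamma (real k * \<alpha> + 1) > 0" for k
    using assms(1,2) by (intro Gamma_real_pos add_nonneg_pos) auto
  have ka: "-1 < real k * \<alpha>" for k
    using mult_nonneg_nonneg[of "real k" \<alpha>] assms(1) by linarith
  have int_term: "set_integrable lborel {0<..<s} (\<lambda>r. (s - r) powr (\<alpha> - 1) * T k r)" for k s
  proof -
    have "set_integrable lborel {0<..<s} (\<lambda>r. C ^ k / Gamma (real k * \<alpha> + 1) *
        ((s - r) powr (\<alpha> - 1) * r powr (real k * \<alpha>)))"
      using riemann_liouville_integrable_powr[OF assms(1) ka[of k], of s] by (intro set_integrable_mult_right)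
    then show ?thesis by (simp add: T_def mult_ac)
  qed
  have int_R: "set_integrable lborel {0<..<s} (\<lambda>r. (s - r) powr (\<alpha> - 1) * R K r)" for K s
  proof (induction K)
    case 0
    show ?case
      using riemann_liouville_integrable_bounded[OF assms(1) meas bound, of s] by (simp add: R_def)
  next
    case (Suc K)
    from set_integral_diff(1)[OF this int_term[of s K]] show ?case
      by (simp add: R_Suc right_diff_distrib)
  qed
  \<comment> \<open>Fractional integration adds \<alpha> to the exponent and exchanges the Gamma
    factor for the next one.\<close>
  have rl_term: "C * riemann_liouville \<alpha> (T k) s = T (Suc k) s" if "s > 0" for k s
  proof -
    have "riemann_liouville \<alpha> (T k) s
        = C ^ k / Gamma (real k * \<alpha> + 1) * riemann_liouville \<alpha> (\<lambda>r. r powr (real k * \<alpha>)) s"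
      by (simp add: riemann_liouville_def T_def[abs_def] mult.left_commute[of _ "C ^ k / _"]
          del: times_divide_eq_left times_divide_eq_right)
    then show ?thesis
      using riemann_liouville_powr[OF assms(1) ka[of k] that] Gpos[of k]
      by (simp add: T_def algebra_simps)
  qed
  \<comment> \<open>Since \<open>T 0\<close> is 1 at positive times, the base case is the equation
    for f; the induction step subtracts \<open>rl_term\<close>.\<close>
  have step: "R (Suc K) s = C * riemann_liouville \<alpha> (R K) s" if "s > 0" for K s
    using that
  proof (induction K)
    case 0
    then show ?case using eq[of s] by (simp add: R_def[abs_def] T_def)
  next
    case (Suc K)
    have "R (Suc (Suc K)) s = C * riemann_liouville \<alpha> (R K) s - C * riemann_liouville \<alpha> (T K) s"
      using Suc rl_term[of s K] by (simp add: R_Suc[of "Suc K"])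
    also have "\<dots> = C * riemann_liouville \<alpha> (R (Suc K)) s"
      using riemann_liouville_diff[OF int_R[of s K] int_term[of s K]]
      by (simp add: R_Suc[of K] right_diff_distrib)
    finally show ?case .
  qed
  have R_le: "\<bar>R K s\<bar> \<le> B * \<bar>C\<bar> ^ K / Gamma (real K * \<alpha> + 1) * s powr (real K * \<alpha>)"
    if "s > 0" for K s
    using that
  proof (induction K arbitrary: s)
    case 0
    then show ?case using bound[of s] by (simp add: R_def)
  next
    case (Suc K)
    have "\<bar>R (Suc K) s\<bar> = \<bar>C\<bar> * \<bar>riemann_liouville \<alpha> (R K) s\<bar>"
      using Suc.prems by (simp add: step abs_mult)
    also have "\<dots> \<le> \<bar>C\<bar> * (B * \<bar>C\<bar> ^ K / Gamma (real K * \<alpha> + 1) *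
        (Gamma (real K * \<alpha> + 1) / Gamma (\<alpha> + real K * \<alpha> + 1) * s powr (\<alpha> + real K * \<alpha>)))"
      using Suc assms(1) by (intro mult_left_mono abs_riemann_liouville_le) auto
    also have "\<dots> = B * \<bar>C\<bar> ^ Suc K / Gamma (real (Suc K) * \<alpha> + 1) * s powr (real (Suc K) * \<alpha>)"
      using Gpos[of K] by (simp add: algebra_simps)
    finally show ?case .
  qed
  have powr_eq: "t powr (real k * \<alpha>) = (t powr \<alpha>) ^ k" for k
    using assms(1,2) by (simp add: mult.commute[of "real k"] powr_powr[symmetric] powr_realpow)
  have "(\<lambda>K. B * ((\<bar>C\<bar> * t powr \<alpha>) ^ K / Gamma (real K * \<alpha> + 1))) \<longlonglongrightarrow> B * 0"
    using assms(1,2) by (intro tendsto_mult tendsto_const power_over_Gamma_tendsto_0) auto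
  then have "(\<lambda>K. R K t) \<longlonglongrightarrow> 0"
    using R_le[OF assms(2)]
    by (intro Lim_null_comparison[where f = "\<lambda>K. R K t"] always_eventually)
      (auto simp: powr_eq power_mult_distrib mult.assoc)
  then have "(\<lambda>K. f t - R K t) \<longlonglongrightarrow> f t - 0"
    by (intro tendsto_intros)
  then show ?thesis
    by (simp add: sums_def R_def T_def powr_eq power_mult_distrib)
qed

subsection \<open>The Caputo derivative as inverse of the Riemann-Liouville integral\<close>

text \<open>The fundamental theorem of calculus gives the Henstock-Kurzweil integral of the
  derivative; Lebesgue integrability identifies the two integrals.\<close>

lemma LBINT_deriv:
  fixes f :: "real \<Rightarrow> real"
  assumes "a \<le> b" "continuous_on {a..b} f"
    and diff: "\<And>s. a < s \<Longrightarrow> s < b \<Longrightarrow> f differentiable at s"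
    and int: "set_integrable lborel {a<..<b} (deriv f)"
  shows "(LBINT s:{a<..<b}. deriv f s) = f b - f a"
proof -
  have "(deriv f has_integral (f b - f a)) {a..b}"
    using diff
    by (intro fundamental_theorem_of_calculus_interior assms(1,2))
      (auto simp: DERIV_deriv_iff_real_differentiable has_real_derivative_iff_has_vector_derivative[symmetric])
  then show ?thesis
    by (simp add: set_borel_integral_eq_integral(2)[OF int] has_integral_Icc_iff_Ioo integral_unique)
qed

text \<open>Multiplying by \<open>(t - s) powr \<alpha>\<close>, which is at most
  \<open>t powr \<alpha>\<close>, removes the singular kernel. This makes the derivative of a Caputo
  differentiable function integrable up to 0.\<close>

lemma set_integrable_of_singular_kernel:
  fixes g :: "real \<Rightarrow> real"
  assumes "\<alpha> \<ge> 0" "t > 0"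
    and int: "set_integrable lborel {0<..<t} (\<lambda>s. (t - s) powr (- \<alpha>) * g s)"
  shows "set_integrable lborel {0<..<t} g"
proof -
  define h where "h s = indicator {0<..<t} s * ((t - s) powr (- \<alpha>) * g s)" for s
  have h: "integrable lborel h"
    using int by (simp add: set_integrable_def h_def[abs_def])
  then have [measurable]: "h \<in> borel_measurable borel"
    using borel_measurable_integrable by fastforce
  have eq: "indicator {0<..<t} s * g s = indicator {0<..<t} s * ((t - s) powr \<alpha> * h s)" for s
    by (auto simp: h_def indicator_def mult.assoc[symmetric] powr_add[symmetric])
  have "integrable lborel (\<lambda>s. indicator {0<..<t} s * ((t - s) powr \<alpha> * h s))"
  proof (rule Bochner_Integration.integrable_bound)
    show "integrable lborel (\<lambda>s. t powr \<alpha> * h s)"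
      using h by simp
    show "(\<lambda>s. indicator {0<..<t} s * ((t - s) powr \<alpha> * h s)) \<in> borel_measurable lborel"
      by measurable
    show "AE s in lborel. norm (indicator {0<..<t} s * ((t - s) powr \<alpha> * h s))
        \<le> norm (t powr \<alpha> * h s)"
      using assms(1,2)
      by (intro AE_I2) (auto simp: indicator_def abs_mult intro!: mult_right_mono powr_mono2)
  qed
  then show ?thesis
    by (simp add: set_integrable_def eq)
qed

text \<open>Applying the integral of order \<open>\<alpha>\<close> to the Caputo derivative: after Fubini the inner integral
  is the Beta integral \<open>B(\<alpha>, 1 - \<alpha>) = \<Gamma>(\<alpha>) \<Gamma>(1 - \<alpha>)\<close>, which leaves the
  integral of \<open>f'\<close>.\<close>

lemma riemann_liouville_caputo_deriv_less_1:
  fixes f :: "real \<Rightarrow> real"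
  assumes "0 < \<alpha>" "\<alpha> < 1" "t > 0" "continuous_on {0..} f"
    and diff: "\<And>s. s > 0 \<Longrightarrow> caputo_differentiable \<alpha> f s"
  shows "riemann_liouville \<alpha> (caputo_deriv \<alpha> f) t = f t - f 0"
proof -
  define g where "g u = indicator {0<..<t} u * deriv f u" for u
  \<comment> \<open>The product of the two singular kernels, cut off to the triangle 0 < u < s <
    t.\<close>
  define k where "k s u = indicator {0<..<t} u * indicator {u<..<t} s *
    ((t - s) powr (\<alpha> - 1) * (s - u) powr (- \<alpha>))" for s u :: real
  \<comment> \<open>Caputo differentiability at a point speaks of strictly earlier times only, hence
    the detour through \<open>s + 1\<close>.\<close>
  have "f differentiable at s" if "s > 0" for s
    using diff[of "s + 1"] assms(2) that by (auto simp: caputo_differentiable_def)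
  moreover have int: "set_integrable lborel {0<..<t} (deriv f)"
    using set_integrable_of_singular_kernel[of \<alpha> t "deriv f"] diff[of t] assms(1-3)
    by (auto simp: caputo_differentiable_def)
  ultimately have FTC: "(LBINT s:{0<..<t}. deriv f s) = f t - f 0"
    using assms by (intro LBINT_deriv) (auto intro: continuous_on_subset)
  have g_int: "integrable lborel g"
    using int by (simp add: set_integrable_def g_def[abs_def])
  then have g_meas[measurable]: "g \<in> borel_measurable borel"
    using borel_measurable_integrable by fastforce
  \<comment> \<open>The exponent of \<open>t - u\<close> in the Beta integral is
    \<open>\<alpha> + (1 - \<alpha>) - 1 = 0\<close>, so the value is the same for all u in the
    interval.\<close>
  have k_int: "has_bochner_integral lborel (\<lambda>s. k s u)
      (indicator {0<..<t} u * (Gamma \<alpha> * Gamma (1 - \<alpha>)))" for u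
    using has_bochner_integral_mult_right[OF has_bochner_integral_Beta_Ioo[of \<alpha> "1 - \<alpha>" u t],
        of "indicator {0<..<t} u"] assms
    by (auto simp: k_def Beta_def mult.assoc indicator_def split: if_splits)
  \<comment> \<open>Joint measurability is read off from a single indicator of a measurable set in
    the plane.\<close>
  have "k s u = indicator {(u, s). 0 < u \<and> u < s \<and> s < t} (u, s) *
    ((t - s) powr (\<alpha> - 1) * (s - u) powr (- \<alpha>))" for u s
    by (auto simp: k_def indicator_def)
  then have k_meas: "(\<lambda>(u, s). k s u) \<in> borel_measurable (lborel \<Otimes>\<^sub>M lborel)"
    by simp
  have "integrable (lborel \<Otimes>\<^sub>M lborel) (\<lambda>(u, s). k s u * g u)"
  proof (rule lborel_pair.Fubini_integrable)
    show "(\<lambda>(u, s). k s u * g u) \<in> borel_measurable (lborel \<Otimes>\<^sub>M lborel)"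
      using k_meas by measurable
    have "(\<integral>s. norm (k s u * g u) \<partial>lborel) = Gamma \<alpha> * Gamma (1 - \<alpha>) * \<bar>g u\<bar>" for u
    proof -
      have "norm (k s u * g u) = k s u * \<bar>g u\<bar>" for s
        by (simp add: abs_mult k_def)
      then show ?thesis
        using k_int[of u] by (simp add: has_bochner_integral_iff) (simp add: g_def indicator_def)
    qed
    then show "integrable lborel (\<lambda>u. \<integral>s. norm (case (u, s) of (u, s) \<Rightarrow> k s u * g u) \<partial>lborel)"
      using g_int by simp
    show "AE u in lborel. integrable lborel (\<lambda>s. case (u, s) of (u, s) \<Rightarrow> k s u * g u)"
      using k_int by (auto simp: has_bochner_integral_iff)
  qed
  then have "(\<integral>s. (\<integral>u. k s u * g u \<partial>lborel) \<partial>lborel) = (\<integral>u. (\<integral>s. k s u * g u \<partial>lborel) \<partial>lborel)"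
    by (rule lborel_pair.Fubini_integral)
  also have "(\<integral>u. (\<integral>s. k s u * g u \<partial>lborel) \<partial>lborel) = (\<integral>u. Gamma \<alpha> * Gamma (1 - \<alpha>) * g u \<partial>lborel)"
    using k_int by (intro Bochner_Integration.integral_cong)
      (auto simp: has_bochner_integral_iff g_def indicator_def)
  also have "\<dots> = Gamma \<alpha> * Gamma (1 - \<alpha>) * (f t - f 0)"
    using FTC by (simp add: g_def set_lebesgue_integral_def)
  finally have *: "(\<integral>s. (\<integral>u. k s u * g u \<partial>lborel) \<partial>lborel)
      = Gamma \<alpha> * Gamma (1 - \<alpha>) * (f t - f 0)" .
  \<comment> \<open>In this order of integration the inner integral is, up to
    \<open>1 / Gamma (1 - \<alpha>)\<close>, the Caputo derivative at s.\<close>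
  have "(\<integral>u. k s u * g u \<partial>lborel) = indicator {0<..<t} s * ((t - s) powr (\<alpha> - 1) *
     (LBINT u:{0<..<s}. (s - u) powr (- \<alpha>) * deriv f u))" for s
  proof -
    have "k s u * g u = indicator {0<..<t} s * (t - s) powr (\<alpha> - 1) *
        (indicator {0<..<s} u * ((s - u) powr (- \<alpha>) * deriv f u))" for u
      by (auto simp: k_def g_def indicator_def)
    then show ?thesis
      by (simp add: set_lebesgue_integral_def)
  qed
  moreover have G: "Gamma \<alpha> \<noteq> 0" "Gamma (1 - \<alpha>) \<noteq> 0"
    using Gamma_real_pos[of \<alpha>] Gamma_real_pos[of "1 - \<alpha>"] assms(1,2) by linarith+
  ultimately have "Gamma \<alpha> * Gamma (1 - \<alpha>) * riemann_liouville \<alpha> (caputo_deriv \<alpha> f) t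
      = Gamma \<alpha> * Gamma (1 - \<alpha>) * (f t - f 0)"
    using assms(2) *
    by (simp add: riemann_liouville_def caputo_deriv_def set_lebesgue_integral_def mult_ac)
  with G show ?thesis
    by simp
qed

text \<open>Adds the case \<open>\<alpha> = 1\<close>: the kernel is 1 on the open interval, the
  last hypothesis becomes integrability of the derivative, and the fundamental theorem of calculus
  applies.\<close>

lemma riemann_liouville_caputo_deriv:
  fixes f :: "real \<Rightarrow> real"
  assumes "0 < \<alpha>" "\<alpha> \<le> 1" "t > 0" "continuous_on {0..} f"
    and diff: "\<And>s. s > 0 \<Longrightarrow> caputo_differentiable \<alpha> f s"
    and int: "set_integrable lborel {0<..<t} (\<lambda>s. (t - s) powr (\<alpha> - 1) * caputo_deriv \<alpha> f s)"
  shows "riemann_liouville \<alpha> (caputo_deriv \<alpha> f) t = f t - f 0"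
proof (cases "\<alpha> = 1")
  case True
  have "set_integrable lborel {0<..<t} (\<lambda>s. (t - s) powr (\<alpha> - 1) * caputo_deriv \<alpha> f s)
      \<longleftrightarrow> set_integrable lborel {0<..<t} (deriv f)"
    using True by (intro set_integrable_cong) (auto simp: caputo_deriv_def)
  with True int have "(LBINT s:{0<..<t}. deriv f s) = f t - f 0"
    using diff assms(3,4)
    by (intro LBINT_deriv) (auto simp: caputo_differentiable_def intro: continuous_on_subset)
  moreover have "(LBINT s:{0<..<t}. (t - s) powr 0 * deriv f s) = (LBINT s:{0<..<t}. deriv f s)"
    by (intro set_lebesgue_integral_cong) auto
  ultimately show ?thesis
    using True by (simp add: riemann_liouville_def caputo_deriv_def)
next
  case False
  then show ?thesis
    using assms by (intro riemann_liouville_caputo_deriv_less_1) auto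
qed

subsection \<open>Generating functions\<close>

lemma riemann_liouville_cmult: "riemann_liouville \<alpha> (\<lambda>s. c * f s) t = c * riemann_liouville \<alpha> f t"
  by (simp add: riemann_liouville_def mult.left_commute[of _ c])

lemma riemann_liouville_sum:
  assumes "\<And>i. i \<in> I \<Longrightarrow> set_integrable lborel {0<..<t} (\<lambda>s. (t - s) powr (\<alpha> - 1) * f i s)"
  shows "riemann_liouville \<alpha> (\<lambda>s. \<Sum>i\<in>I. f i s) t = (\<Sum>i\<in>I. riemann_liouville \<alpha> (f i) t)"
  using Bochner_Integration.integral_sum[of I, OF assms[unfolded set_integrable_def]]
  by (simp add: riemann_liouville_def set_lebesgue_integral_def sum_distrib_left sum_divide_distrib)

text \<open>The majorant is B times the kernel, which is integrable for \<open>\<alpha> > 0\<close>;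
  the limit inherits measurability from the sequence.\<close>

lemma riemann_liouville_dominated_convergence:
  fixes f :: "real \<Rightarrow> real" and g :: "nat \<Rightarrow> real \<Rightarrow> real"
  assumes "\<alpha> > 0"
    and meas: "\<And>K. set_borel_measurable borel {0<..<t} (g K)"
    and bound: "\<And>K s. 0 < s \<Longrightarrow> s < t \<Longrightarrow> \<bar>g K s\<bar> \<le> B"
    and lim: "\<And>s. 0 < s \<Longrightarrow> s < t \<Longrightarrow> (\<lambda>K. g K s) \<longlonglongrightarrow> f s"
  shows "(\<lambda>K. riemann_liouville \<alpha> (g K) t) \<longlonglongrightarrow> riemann_liouville \<alpha> f t"
proof -
  define h where "h K s = indicator {0<..<t} s * ((t - s) powr (\<alpha> - 1) * g K s)" for K s
  have "integrable lborel (h K)" for K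
    using riemann_liouville_integrable_bounded[OF assms(1) meas bound, of K]
    by (simp add: set_integrable_def h_def[abs_def])
  then have h_meas: "h K \<in> borel_measurable lborel" for K
    by (rule borel_measurable_integrable)
  have h_lim: "(\<lambda>K. h K s) \<longlonglongrightarrow> indicator {0<..<t} s * ((t - s) powr (\<alpha> - 1) * f s)" for s
    using lim[of s] by (auto simp: h_def indicator_def intro!: tendsto_intros)
  have "(\<lambda>K. integral\<^sup>L lborel (h K)) \<longlonglongrightarrow>
    (LBINT s. indicator {0<..<t} s * ((t - s) powr (\<alpha> - 1) * f s))"
  proof (rule integral_dominated_convergence)
    show "integrable lborel (\<lambda>s. indicator {0<..<t} s * ((t - s) powr (\<alpha> - 1) * s powr 0 * B))"
      using riemann_liouville_integrable_powr[OF assms(1), of 0 t]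
      by (simp add: set_integrable_def mult.assoc[symmetric] del: powr_zero_eq_one)
    show "AE s in lborel. norm (h K s)
        \<le> indicator {0<..<t} s * ((t - s) powr (\<alpha> - 1) * s powr 0 * B)" for K
      using bound[of _ K]
      by (intro AE_I2) (auto simp: h_def indicator_def abs_mult intro!: mult_left_mono)
    show "(\<lambda>s. indicator {0<..<t} s * ((t - s) powr (\<alpha> - 1) * f s)) \<in> borel_measurable lborel"
      by (rule borel_measurable_LIMSEQ_real[OF h_lim h_meas])
  qed (use h_meas h_lim in auto)
  then show ?thesis
    unfolding riemann_liouville_def
    by (intro tendsto_intros) (simp add: h_def[abs_def] set_lebesgue_integral_def)
qed

lemma Cauchy_product_partial_sums_le:
  fixes a b :: "nat \<Rightarrow> real"
  assumes "\<And>n. a n \<ge> 0" "\<And>n. b n \<ge> 0" "summable a" "summable b"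
  shows "(\<Sum>n<K. \<Sum>i\<le>n. a i * b (n - i)) \<le> suminf a * suminf b"
proof -
  have "(\<lambda>n. \<Sum>i\<le>n. a i * b (n - i)) sums (suminf a * suminf b)"
    using assms by (intro Cauchy_product_sums) auto
  then show ?thesis
    using assms(1,2) by (metis (no_types, lifting) sum_le_suminf finite_lessThan mult_nonneg_nonneg sum_nonneg sums_iff)
qed

text \<open>Multiply the n-th Volterra equation by \<open>x ^ n\<close> and sum. Dominated
  convergence moves the sum under the fractional integral, and the Cauchy product factors the
  integrand.\<close>

lemma generating_function_volterra:
  fixes p :: "nat \<Rightarrow> real \<Rightarrow> real" and c :: "nat \<Rightarrow> real"
  assumes "\<alpha> > 0" "0 \<le> x" "x \<le> 1" "t > 0"
    and meas: "\<And>n. set_borel_measurable borel {0<..<t} (p n)"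
    and nonneg: "\<And>n s. s > 0 \<Longrightarrow> p n s \<ge> 0"
    and sums_1: "\<And>s. s > 0 \<Longrightarrow> (\<lambda>n. p n s) sums 1"
    and c: "summable (\<lambda>n. \<bar>c n\<bar>)"
    and volterra: "\<And>n. p n t = (if n = 0 then 1 else 0)
      + riemann_liouville \<alpha> (\<lambda>s. \<Sum>i\<le>n. c i * p (n - i) s) t"
  shows "(\<Sum>n. x ^ n * p n t)
    = 1 + (\<Sum>n. c n * x ^ n) * riemann_liouville \<alpha> (\<lambda>s. \<Sum>n. x ^ n * p n s) t"
proof -
  define F where "F s = (\<Sum>n. x ^ n * p n s)" for s
  define C where "C = (\<Sum>n. c n * x ^ n)"
  define g where "g n s = (\<Sum>i\<le>n. c i * p (n - i) s)" for n s
  define D where "D = (\<Sum>n. \<bar>c n\<bar>)"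
  have x: "x ^ n \<le> 1" for n
    using assms by (simp add: power_le_one)
  have p_sm: "summable (\<lambda>n. p n s)" and p_sum: "(\<Sum>n. p n s) = 1" if "s > 0" for s
    using sums_1[OF that] by (auto simp: sums_iff)
  have xp_sm: "summable (\<lambda>n. x ^ n * p n s)" if "s > 0" for s
    using x nonneg[OF that] assms
    by (intro summable_comparison_test_ev[OF _ p_sm[OF that]] always_eventually)
      (auto simp: abs_mult intro: mult_left_le_one_le)
  \<comment> \<open>The l1 bound for convolutions: the norm of c is D and that of the probabilities
    is 1. The bound is uniform in K and s, as dominated convergence requires.\<close>
  have g_abs: "(\<Sum>n<K. \<bar>g n s\<bar>) \<le> D" if "s > 0" for K s
  proof -
    have "(\<Sum>n<K. \<bar>g n s\<bar>) \<le> (\<Sum>n<K. \<Sum>i\<le>n. \<bar>c i\<bar> * p (n - i) s)"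
      unfolding g_def using nonneg[OF that]
      by (intro sum_mono order.trans[OF sum_abs]) (simp add: abs_mult)
    also have "\<dots> \<le> D * (\<Sum>n. p n s)"
      unfolding D_def using c nonneg[OF that] p_sm[OF that]
      by (intro Cauchy_product_partial_sums_le) auto
    finally show ?thesis using p_sum[OF that] by simp
  qed
  have g_meas: "set_borel_measurable borel {0<..<t} (g n)" for n
  proof -
    have [measurable]: "(\<lambda>s. indicator {0<..<t} s * p n s) \<in> borel_measurable borel" for n
      using meas[of n] by (simp add: set_borel_measurable_def)
    have "(\<lambda>s. \<Sum>i\<le>n. c i * (indicator {0<..<t} s * p (n - i) s)) \<in> borel_measurable borel"
      by measurable
    then show ?thesis
      by (simp add: set_borel_measurable_def g_def sum_distrib_left mult.left_commute)
  qed
  have sum_meas: "set_borel_measurable borel {0<..<t} (\<lambda>s. \<Sum>n<K. x ^ n * g n s)" for K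
  proof -
    have [measurable]: "(\<lambda>s. indicator {0<..<t} s * g n s) \<in> borel_measurable borel" for n
      using g_meas[of n] by (simp add: set_borel_measurable_def)
    have "(\<lambda>s. \<Sum>n<K. x ^ n * (indicator {0<..<t} s * g n s)) \<in> borel_measurable borel"
      by measurable
    then show ?thesis
      by (simp add: set_borel_measurable_def sum_distrib_left mult.left_commute)
  qed
  have g_int: "set_integrable lborel {0<..<t} (\<lambda>s. (t - s) powr (\<alpha> - 1) * g n s)" for n
  proof (rule riemann_liouville_integrable_bounded[OF assms(1) g_meas])
    show "\<bar>g n s\<bar> \<le> D" if "0 < s" for s
      by (rule order.trans[OF member_le_sum[of n "{..<Suc n}" "\<lambda>n. \<bar>g n s\<bar>"] g_abs[OF that]]) auto
  qed
  have "(\<lambda>K. riemann_liouville \<alpha> (\<lambda>s. \<Sum>n<K. x ^ n * g n s) t) \<longlonglongrightarrow> riemann_liouville \<alpha> (\<lambda>s. C * F s) t"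
  proof (rule riemann_liouville_dominated_convergence[OF assms(1) sum_meas])
    fix K and s :: real assume s: "0 < s"
    have "\<bar>\<Sum>n<K. x ^ n * g n s\<bar> \<le> (\<Sum>n<K. \<bar>g n s\<bar>)"
      using x assms by (intro order.trans[OF sum_abs] sum_mono)
        (auto simp: abs_mult intro: mult_left_le_one_le)
    then show "\<bar>\<Sum>n<K. x ^ n * g n s\<bar> \<le> D"
      using g_abs[OF s, of K] by linarith
  next
    fix s :: real assume s: "0 < s"
    have "summable (\<lambda>n. \<bar>c n * x ^ n\<bar>)"
      using x assms by (intro summable_comparison_test_ev[OF _ c] always_eventually)
        (auto simp: abs_mult intro: mult_left_le)
    moreover have "summable (\<lambda>n. \<bar>x ^ n * p n s\<bar>)"
      using xp_sm[OF s] nonneg[OF s] assms by simp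
    \<comment> \<open>Splitting \<open>x ^ n\<close> as \<open>x ^ i * x ^ (n - i)\<close> makes the
      weighted convolution a Cauchy product.\<close>
    ultimately have "(\<lambda>n. \<Sum>i\<le>n. (c i * x ^ i) * (x ^ (n - i) * p (n - i) s)) sums (C * F s)"
      unfolding C_def F_def by (intro Cauchy_product_sums) auto
    moreover have "(\<Sum>i\<le>n. (c i * x ^ i) * (x ^ (n - i) * p (n - i) s)) = x ^ n * g n s" for n
      unfolding g_def sum_distrib_left
    proof (rule sum.cong)
      fix i assume "i \<in> {..n}"
      then have "x ^ n = x ^ i * x ^ (n - i)"
        by (simp add: power_add[symmetric])
      then show "(c i * x ^ i) * (x ^ (n - i) * p (n - i) s) = x ^ n * (c i * p (n - i) s)"
        by simp
    qed simp
    ultimately show "(\<lambda>K. \<Sum>n<K. x ^ n * g n s) \<longlonglongrightarrow> C * F s"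
      by (simp add: sums_def)
  qed
  also have "(\<lambda>K. riemann_liouville \<alpha> (\<lambda>s. \<Sum>n<K. x ^ n * g n s) t)
      = (\<lambda>K. \<Sum>n<K. x ^ n * riemann_liouville \<alpha> (g n) t)"
    using set_integrable_mult_right[OF g_int]
    by (subst riemann_liouville_sum) (auto simp: riemann_liouville_cmult mult.left_commute)
  finally have "(\<lambda>n. x ^ n * riemann_liouville \<alpha> (g n) t) sums (C * riemann_liouville \<alpha> F t)"
    by (simp add: sums_def riemann_liouville_cmult)
  then have "(\<lambda>n. (if n = 0 then 1 else 0) + x ^ n * riemann_liouville \<alpha> (g n) t)
      sums (1 + C * riemann_liouville \<alpha> F t)"
    by (intro sums_add sums_single)
  moreover have "(if n = 0 then 1 else 0) + x ^ n * riemann_liouville \<alpha> (g n) t = x ^ n * p n t" for n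
    using volterra[of n] by (simp add: g_def[abs_def])
  ultimately show ?thesis
    by (simp add: sums_iff F_def[abs_def] C_def)
qed

text \<open>Dominated convergence for the truncations \<open>S K\<close>, which agree with h(X)
  where X < K and vanish elsewhere.\<close>

lemma (in prob_space) expectation_nat_sums:
  fixes X :: "'a \<Rightarrow> nat" and h :: "nat \<Rightarrow> real"
  assumes [measurable]: "X \<in> measurable M (count_space UNIV)"
    and bound: "\<And>n. \<bar>h n\<bar> \<le> B"
  shows "(\<lambda>n. h n * prob {\<omega> \<in> space M. X \<omega> = n}) sums expectation (\<lambda>\<omega>. h (X \<omega>))"
proof -
  define S where "S K \<omega> = (\<Sum>n<K. h n * indicator {\<omega> \<in> space M. X \<omega> = n} \<omega>)" for K \<omega>
  have S: "S K \<omega> = (if X \<omega> < K then h (X \<omega>) else 0)" if "\<omega> \<in> space M" for K \<omega>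
    using that by (simp add: S_def indicator_def if_distrib sum.delta' cong: if_cong)
  have "(\<lambda>K. expectation (S K)) \<longlonglongrightarrow> expectation (\<lambda>\<omega>. h (X \<omega>))"
  proof (rule integral_dominated_convergence)
    show "AE \<omega> in M. norm (S K \<omega>) \<le> \<bar>B\<bar>" for K
      using bound order.trans[OF bound abs_ge_self] by (intro AE_I2) (auto simp: S)
    show "AE \<omega> in M. (\<lambda>K. S K \<omega>) \<longlonglongrightarrow> h (X \<omega>)"
    proof (rule AE_I2)
      fix \<omega> assume "\<omega> \<in> space M"
      then show "(\<lambda>K. S K \<omega>) \<longlonglongrightarrow> h (X \<omega>)"
        by (intro tendsto_eventually eventually_mono[OF eventually_gt_at_top[of "X \<omega>"]])
          (auto simp: S)
    qed
  qed (auto simp: S_def[abs_def])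
  moreover have "expectation (S K) = (\<Sum>n<K. h n * prob {\<omega> \<in> space M. X \<omega> = n})" for K
    unfolding S_def by (subst Bochner_Integration.integral_sum)
      (auto simp: less_top[symmetric] intro!: integrable_real_indicator)
  ultimately show ?thesis
    by (simp add: sums_def)
qed

subsection \<open>State probabilities and intensities\<close>

lemma set_integrable_sum:
  fixes f :: "'i \<Rightarrow> 'a \<Rightarrow> 'b::{banach, second_countable_topology}"
  assumes "\<And>i. i \<in> I \<Longrightarrow> set_integrable M A (f i)"
  shows "set_integrable M A (\<lambda>x. \<Sum>i\<in>I. f i x)"
  using assms unfolding set_integrable_def scaleR_sum_right
  by (rule Bochner_Integration.integrable_sum)

text \<open>The factor a kills all j < 0 and the factor b all j > n, so only \<open>{0..n}\<close>
  contributes.\<close>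

lemma discrete_convolution_eq_sum:
  assumes "\<And>j. j < 0 \<Longrightarrow> a j = 0" "\<And>j. j < 0 \<Longrightarrow> b j = 0"
  shows "discrete_convolution a b (int n) = (\<Sum>i\<le>n. a (int i) * b (int (n - i)))"
proof -
  have "discrete_convolution a b (int n) = (\<Sum>\<^sub>\<infinity>j\<in>int ` {..n}. a j * b (int n - j))"
    unfolding discrete_convolution_def
  proof (rule infsum_cong_neutral)
    fix j assume "j \<in> UNIV - int ` {..n}"
    then have "j < 0 \<or> int n - j < 0"
      by (metis DiffD2 atMost_iff image_eqI int_nat_eq linorder_not_less diff_less_0_iff_less
          nat_le_iff)
    then show "a j * b (int n - j) = 0"
      using assms by auto
  qed auto
  also have "\<dots> = (\<Sum>i\<le>n. a (int i) * b (int n - int i))"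
    by (simp add: sum.reindex)
  also have "\<dots> = (\<Sum>i\<le>n. a (int i) * b (int (n - i)))"
    by (intro sum.cong) (auto simp: of_nat_diff)
  finally show ?thesis .
qed

text \<open>Moving the shift from the state to the intensities lets both convolutions of the state
  equation be evaluated at the same n, including n = 0, where \<open>n - 1\<close> is
  negative.\<close>

lemma discrete_convolution_shift:
  "discrete_convolution a b (n - 1) = discrete_convolution (\<lambda>j. a (j - 1)) b n"
  unfolding discrete_convolution_def
  by (rule infsum_reindex_bij_witness[of _ "\<lambda>j. j - 1" "\<lambda>j. j + 1"]) (auto simp: algebra_simps)

text \<open>The term for j = 0 is \<open>lam 0\<close>, because \<open>lam (-1) = 0\<close>; by
  monotonicity the later terms telescope, so the partial sums stay below
  \<open>2 * lam 0\<close>.\<close>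

lemma summable_abs_decrements:
  assumes "intensity_parameters lam"
  shows "summable (\<lambda>j. \<bar>lam (int j - 1) - lam (int j)\<bar>)"
proof -
  have neg: "lam j = 0" if "j < 0" for j
    using assms that by (simp add: intensity_parameters_def)
  have nonneg: "lam (int j) \<ge> 0" for j
    using assms unfolding intensity_parameters_def by (cases j) (auto simp: less_imp_le)
  have mono: "lam (int (Suc j)) \<le> lam (int j)" for j
    using assms by (simp add: intensity_parameters_def)
  have "(\<Sum>j\<le>K. \<bar>lam (int j - 1) - lam (int j)\<bar>) = 2 * lam 0 - lam (int K)" for K
  proof (induction K)
    case 0
    then show ?case using nonneg[of 0] neg[of "-1"] by simp
  next
    case (Suc K)
    then show ?case using mono[of K] by simp
  qed
  then show ?thesis
    using nonneg by (intro bounded_imp_summable[where B = "2 * lam 0"]) auto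
qed

section \<open>The moment generating function of the process\<close>

theorem proposition3p4:
  fixes M :: "'w measure" and N :: "real \<Rightarrow> 'w \<Rightarrow> nat"
    and \<alpha> :: real and lam :: "int \<Rightarrow> real" and w t :: real
  assumes "0 < \<alpha>" and "\<alpha> \<le> 1"
    and "intensity_parameters lam"
    and "convoluted_fractional_poisson_process M N \<alpha> lam"
    and "w \<ge> 0" and "t \<ge> 0"
  shows "prob_space.expectation M (\<lambda>\<omega>. exp (- w * real (N t \<omega>))) =
         mittag_leffler \<alpha> 1
           (t powr \<alpha> * (\<Sum>j. (lam (int j - 1) - lam (int j)) * exp (- w * real j)))"
proof -
  interpret convoluted_fractional_poisson_process M N \<alpha> lam by fact
  define x where "x = exp (- w)"
  define c where "c n = lam (int n - 1) - lam (int n)" for n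
  define p where "p n = state_prob M N (int n)" for n
  define F where "F s = (\<Sum>n. x ^ n * p n s)" for s
  define C where "C = (\<Sum>n. c n * x ^ n)"
  have x: "0 \<le> x" "x \<le> 1"
    using assms(5) by (auto simp: x_def)
  have exp_x: "exp (- w * real n) = x ^ n" for n
    by (simp add: x_def exp_of_nat_mult[symmetric] mult.commute)
  have lam_neg: "lam j = 0" if "j < 0" for j
    using assms(3) that by (simp add: intensity_parameters_def)
  have p_eq: "p n s = prob {\<omega> \<in> space M. N s \<omega> = n}" for n s
    by (simp add: p_def state_prob_def)
  have F_sums: "(\<lambda>n. x ^ n * p n s) sums expectation (\<lambda>\<omega>. x ^ N s \<omega>)" if "s \<ge> 0" for s
    unfolding p_eq using x
    by (intro expectation_nat_sums[where B = 1] random_variable_N that) (simp add: power_le_one)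
  have p_sums: "(\<lambda>n. p n s) sums 1" if "s \<ge> 0" for s
    using expectation_nat_sums[OF random_variable_N[OF that], of "\<lambda>_. 1" 1]
    by (simp add: p_eq prob_space)
  have p_nonneg: "p n s \<ge> 0" for n s
    by (simp add: p_eq)
  have p_le: "p n s \<le> 1" for n s
    by (simp add: p_eq)
  have p_cont: "continuous_on {0..} (p n)" for n
    unfolding p_def by (intro continuous_state_prob) simp
  have p_meas: "set_borel_measurable borel {0<..<s} (p n)" for n s
    by (intro set_measurable_continuous_on continuous_on_subset[OF p_cont]) auto
  have p_0: "p n 0 = (if n = 0 then 1 else 0)" for n
    using initial_zero initial_pos[of "int n"] by (simp add: p_def)
  \<comment> \<open>After the shift the two convolutions differ only in their intensities, and the
    difference of these is c.\<close>
  have state_eq: "caputo_deriv \<alpha> (p n) s = (\<Sum>i\<le>n. c i * p (n - i) s)" if "s > 0" for n s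
  proof -
    have neg: "state_prob M N k s = 0" if "k < 0" for k
      using that by (auto simp: state_prob_def)
    show ?thesis
      using state_equation[of "int n" s] that lam_neg neg
      by (simp add: p_def c_def discrete_convolution_shift discrete_convolution_eq_sum
          sum_subtractf left_diff_distrib)
  qed
  \<comment> \<open>The right-hand side of the state equation is a finite combination of
    probabilities, hence bounded and integrable against the kernel; fractional integration then
    inverts the Caputo derivative.\<close>
  have volterra: "p n s = (if n = 0 then 1 else 0)
      + riemann_liouville \<alpha> (\<lambda>s. \<Sum>i\<le>n. c i * p (n - i) s) s" if "s > 0" for n s
  proof -
    have eq: "set_integrable lborel {0<..<s} (\<lambda>r. (s - r) powr (\<alpha> - 1) * caputo_deriv \<alpha> (p n) r)
        \<longleftrightarrow> set_integrable lborel {0<..<s} (\<lambda>r. \<Sum>i\<le>n. c i * ((s - r) powr (\<alpha> - 1) * p (n - i) r))"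
      by (intro set_integrable_cong) (auto simp: state_eq sum_distrib_left mult.left_commute)
    have "riemann_liouville \<alpha> (caputo_deriv \<alpha> (p n)) s = p n s - p n 0"
    proof (rule riemann_liouville_caputo_deriv[OF assms(1,2) that p_cont])
      show "caputo_differentiable \<alpha> (p n) r" if "r > 0" for r
        unfolding p_def using that by (intro caputo_differentiable_state_prob) auto
      show "set_integrable lborel {0<..<s} (\<lambda>r. (s - r) powr (\<alpha> - 1) * caputo_deriv \<alpha> (p n) r)"
        unfolding eq using p_nonneg p_le
        by (intro set_integrable_sum set_integrable_mult_right
             riemann_liouville_integrable_bounded[where B = 1] p_meas assms(1)) auto
    qed
    moreover have "riemann_liouville \<alpha> (caputo_deriv \<alpha> (p n)) s
        = riemann_liouville \<alpha> (\<lambda>s. \<Sum>i\<le>n. c i * p (n - i) s) s"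
      by (intro riemann_liouville_cong state_eq)
    ultimately show ?thesis using p_0 by simp
  qed
  have "summable (\<lambda>n. \<bar>c n\<bar>)"
    using summable_abs_decrements[OF assms(3)] by (simp add: c_def)
  then have F_volterra: "F s = 1 + C * riemann_liouville \<alpha> F s" if "s > 0" for s
    using generating_function_volterra[OF assms(1) x that p_meas p_nonneg p_sums _ volterra[OF that]]
    by (simp add: F_def[abs_def] C_def)
  have F_sums': "(\<lambda>n. x ^ n * p n s) sums F s" if "s \<ge> 0" for s
    using F_sums[OF that] by (simp add: F_def sums_iff)
  have F_bound: "\<bar>F s\<bar> \<le> 1" if "s > 0" for s
  proof -
    have "F s \<le> 1"
      using that x p_nonneg
      by (intro sums_le[OF _ F_sums'[of s] p_sums[of s]]) (auto intro: mult_left_le_one_le power_le_one)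
    moreover have "0 \<le> F s"
      using that x p_nonneg by (intro sums_le[OF _ sums_zero F_sums']) auto
    ultimately show ?thesis by simp
  qed
  \<comment> \<open>Each summand is measurable by continuity of the state probabilities, and so is
    the series; the indicator is pulled through it pointwise.\<close>
  have F_meas: "set_borel_measurable borel {0<..<s} F" for s
  proof -
    have [measurable]: "(\<lambda>r. indicator {0<..<s} r * p n r) \<in> borel_measurable borel" for n
      using p_meas[of s n] by (simp add: set_borel_measurable_def)
    have "(\<lambda>r. \<Sum>n. x ^ n * (indicator {0<..<s} r * p n r)) \<in> borel_measurable borel"
      by measurable
    moreover have "(\<Sum>n. x ^ n * (indicator {0<..<s} r * p n r)) = indicator {0<..<s} r * F r" for r
      by (simp add: F_def indicator_def)
    ultimately show ?thesis
      by (simp add: set_borel_measurable_def)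
  qed
  have "(\<lambda>k. (t powr \<alpha> * C) ^ k / Gamma (real k * \<alpha> + 1)) sums F t"
  \<comment> \<open>The Volterra equation holds at positive times only. At 0 the series reduces to
    its term k = 0, and F is 1 by the initial condition.\<close>
  proof (cases "t = 0")
    case True
    have "(\<lambda>n. x ^ n * p n 0) sums 1"
      using sums_single[of 0 "\<lambda>_. 1 :: real"] by (simp add: p_0 if_distrib cong: if_cong)
    then have "F 0 = 1"
      by (simp add: F_def sums_iff)
    then show ?thesis
      using True powser_sums_zero[of "\<lambda>k. 1 / Gamma (real k * \<alpha> + 1)"] by simp
  next
    case False
    then show ?thesis
      using riemann_liouville_volterra_sums[OF assms(1) _ F_meas F_bound F_volterra, of t] assms(6)
      by (simp add: mult.commute)
  qed
  moreover have "expectation (\<lambda>\<omega>. x ^ N t \<omega>) = F t"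
    using F_sums[OF assms(6)] by (simp add: F_def sums_iff)
  ultimately show ?thesis
    unfolding exp_x by (simp add: mittag_leffler_def C_def c_def sums_iff)
qed

end
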